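(* Suppose that $\Psi$ is finite with $\nu_\Psi$ equal to counting measure and that $\pi_\Psi(\psi)>0$ for every $\psi\in\Psi$. Let $\gamma\in[0,1]$. Then for the loss function $$L(\theta,\psi)=\frac{I(\Psi(\theta)\neq\psi)}{\pi_\Psi(\Psi(\theta))},$$ the $\gamma$-relative surprise region $C_\gamma(x)$ is a $\gamma$-lowest posterior loss credible region, i.e. $C_\gamma(x)=L_\gamma(x)$.
   Context: Setting: $\{f_\theta:\theta\in\Theta\}$ is a family of probability densities with respect to a support measure $\mu$ on a sample space $\mathcal X$. $\Pi$ is a proper prior (probability measure) on $\Theta$ with density $\pi$ with respect to a support measure $\nu$. Put $m(x)=\int_\Theta \pi(\theta)f_\theta(x)\,\nu(d\theta)$. The posterior $\Pi(\cdot\,|\,x)$ has density $\pi(\theta\,|\,x)=\pi(\theta)f_\theta(x)/m(x)$ with respect to $\nu$ (for $x$ with $0<m(x)<\infty$). A (measurable) map $\Psi:\Theta\to\Psi$ is given; the same symbol $\Psi$ denotes the map and its target space. $\Pi_\Psi$ and $\Pi_\Psi(\cdot\,|\,x)$ are the marginal prior and marginal posterior of $\psi=\Psi(\theta)$, with densities $\pi_\Psi$ and $\pi_\Psi(\cdot\,|\,x)$ with respect to a support measure $\nu_\Psi$ on $\Psi$. $I(\cdot)$ is the indicator. The $\gamma$-relative surprise region is $C_\gamma(x)=\{\psi:\pi_\Psi(\psi\,|\,x)/\pi_\Psi(\psi)\geq c_\gamma(x)\}$ with $c_\gamma(x)=\sup\{k:\Pi_\Psi(\{\psi:\pi_\Psi(\psi\,|\,x)/\pi_\Psi(\psi)\geq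 k\}\,|\,x)\geq\gamma\}$. For a loss $L:\Theta\times\Psi\to[0,\infty)$ the posterior risk of the constant action $\psi$ is $r(\psi\,|\,x)=\int_\Theta L(\theta,\psi)\pi(\theta\,|\,x)\,\nu(d\theta)$, and the $\gamma$-lowest posterior loss credible region is $L_\gamma(x)=\{\psi:r(\psi\,|\,x)\leq l_\gamma(x)\}$ with $l_\gamma(x)=\inf\{k:\Pi_\Psi(\{\psi:r(\psi\,|\,x)\leq k\}\,|\,x)\geq\gamma\}$. In these sup and inf, $k$ ranges over the real numbers and values $\pm\infty$ are allowed. *)

theory Defs
  imports "HOL-Probability.Probability"
begin

definition is_prob_density :: "'a measure \<Rightarrow> ('a \<Rightarrow> real) \<Rightarrow> bool" where
  "is_prob_density M p \<longleftrightarrow>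
     p \<in> borel_measurable M \<and> (\<forall>a\<in>space M. 0 \<le> p a) \<and> prob_space (density M p)"

definition prior :: "'t measure \<Rightarrow> ('t \<Rightarrow> real) \<Rightarrow> 't measure" where
  "prior \<nu> p = density \<nu> p"

definition prior_predictive ::
  "'t measure \<Rightarrow> ('t \<Rightarrow> real) \<Rightarrow> ('t \<Rightarrow> 'x \<Rightarrow> real) \<Rightarrow> 'x \<Rightarrow> ennreal" where
  "prior_predictive \<nu> p f x = (\<integral>\<^sup>+ \<theta>. ennreal (p \<theta> * f \<theta> x) \<partial>\<nu>)"

text \<open>The posterior is meaningful only for \<open>0 < prior_predictive \<nu> p f x < \<infinity>\<close>.\<close>

definition posterior_density ::
  "'t measure \<Rightarrow> ('t \<Rightarrow> real) \<Rightarrow> ('t \<Rightarrow> 'x \<Rightarrow> real) \<Rightarrow> 'x \<Rightarrow> 't \<Rightarrow> real" where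
  "posterior_density \<nu> p f x \<theta> = p \<theta> * f \<theta> x / enn2real (prior_predictive \<nu> p f x)"

definition posterior ::
  "'t measure \<Rightarrow> ('t \<Rightarrow> real) \<Rightarrow> ('t \<Rightarrow> 'x \<Rightarrow> real) \<Rightarrow> 'x \<Rightarrow> 't measure" where
  "posterior \<nu> p f x = density \<nu> (posterior_density \<nu> p f x)"

definition posterior_risk ::
  "'t measure \<Rightarrow> ('t \<Rightarrow> real) \<Rightarrow> ('t \<Rightarrow> 'x \<Rightarrow> real) \<Rightarrow> ('t \<Rightarrow> 's \<Rightarrow> real) \<Rightarrow> 'x \<Rightarrow> 's \<Rightarrow> ennreal" where
  "posterior_risk \<nu> p f L x \<psi> = (\<integral>\<^sup>+ \<theta>. ennreal (L \<theta> \<psi> * posterior_density \<nu> p f x \<theta>) \<partial>\<nu>)"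

text \<open>
  In the following, \<open>N\<close> is the marginal posterior of the parameter of interest, \<open>p\<close> and \<open>q\<close> are the
  marginal prior and posterior densities, and \<open>r\<close> is the posterior risk of the constant actions.
  The cutoffs are extended real suprema and infima over real \<open>k\<close>; for \<open>\<gamma> \<le> 0\<close> they are \<open>\<infinity>\<close> and
  \<open>-\<infinity>\<close>.
\<close>

definition rel_surprise_cutoff ::
  "'s measure \<Rightarrow> ('s \<Rightarrow> real) \<Rightarrow> ('s \<Rightarrow> real) \<Rightarrow> real \<Rightarrow> ereal" where
  "rel_surprise_cutoff N p q \<gamma> =
     (SUP k \<in> {k :: real. measure N {\<psi> \<in> space N. q \<psi> / p \<psi> \<ge> k} \<ge> \<gamma>}. ereal k)"

definition rel_surprise_region ::
  "'s measure \<Rightarrow> ('s \<Rightarrow> real) \<Rightarrow> ('s \<Rightarrow> real) \<Rightarrow> real \<Rightarrow> 's set" where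
  "rel_surprise_region N p q \<gamma> =
     {\<psi> \<in> space N. ereal (q \<psi> / p \<psi>) \<ge> rel_surprise_cutoff N p q \<gamma>}"

definition lowest_loss_cutoff :: "'s measure \<Rightarrow> ('s \<Rightarrow> ennreal) \<Rightarrow> real \<Rightarrow> ereal" where
  "lowest_loss_cutoff N r \<gamma> =
     (INF k \<in> {k :: real. measure N {\<psi> \<in> space N. enn2ereal (r \<psi>) \<le> ereal k} \<ge> \<gamma>}. ereal k)"

definition lowest_loss_region :: "'s measure \<Rightarrow> ('s \<Rightarrow> ennreal) \<Rightarrow> real \<Rightarrow> 's set" where
  "lowest_loss_region N r \<gamma> =
     {\<psi> \<in> space N. enn2ereal (r \<psi>) \<le> lowest_loss_cutoff N r \<gamma>}"

definition rel_surprise_loss :: "('s \<Rightarrow> real) \<Rightarrow> ('t \<Rightarrow> 's) \<Rightarrow> 't \<Rightarrow> 's \<Rightarrow> real" where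
  "rel_surprise_loss p \<Psi> \<theta> \<psi> = of_bool (\<Psi> \<theta> \<noteq> \<psi>) / p (\<Psi> \<theta>)"

end

theory Submission
  imports Defs
begin

text \<open>
  Write \<open>g \<psi> = q \<psi> / p \<psi>\<close> for the ratio of the marginal posterior to the marginal prior density.
  The posterior expectation of the loss is \<open>r \<psi> = \<Sum>s \<noteq> \<psi>. g s = T - g \<psi>\<close>, where
  \<open>T = \<Sum>s. g s\<close> is the same for all actions and is finite because there are only finitely many
  values of the parameter of interest (lemma \<open>posterior_risk_rel_surprise_loss\<close>).
  A small risk is therefore the same as a large ratio \<open>g \<psi>\<close>: the sublevel
  set of \<open>r\<close> at \<open>k\<close> is the superlevel set of \<open>g\<close> at \<open>T - k\<close>, so the reflection
  \<open>k \<mapsto> T - k\<close> carries the levels admitted in one cutoff to those admitted in the other, and the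
  two regions coincide (lemma \<open>rel_surprise_region_eq_lowest_loss_region\<close>).
\<close>

text \<open>
  Being beyond the cutoff is being beyond every admissible real level. Comparing the regions through
  this description avoids arithmetic with the cutoffs, which may be infinite.
\<close>

lemma mem_rel_surprise_region_iff:
  "\<psi> \<in> rel_surprise_region N p q \<gamma> \<longleftrightarrow>
     \<psi> \<in> space N \<and> (\<forall>k. \<gamma> \<le> measure N {s \<in> space N. k \<le> q s / p s} \<longrightarrow> k \<le> q \<psi> / p \<psi>)"
  by (auto simp: rel_surprise_region_def rel_surprise_cutoff_def SUP_le_iff)

lemma mem_lowest_loss_region_iff:
  "\<psi> \<in> lowest_loss_region N r \<gamma> \<longleftrightarrow>
     \<psi> \<in> space N \<and> (\<forall>k. \<gamma> \<le> measure N {s \<in> space N. enn2ereal (r s) \<le> ereal k} \<longrightarrow>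
       enn2ereal (r \<psi>) \<le> ereal k)"
  by (auto simp: lowest_loss_region_def lowest_loss_cutoff_def le_INF_iff)

lemma rel_surprise_region_eq_lowest_loss_region:
  assumes r: "\<And>s. s \<in> space N \<Longrightarrow> r s = ennreal (T - q s / p s)"
    and T: "\<And>s. s \<in> space N \<Longrightarrow> q s / p s \<le> T"
  shows "rel_surprise_region N p q \<gamma> = lowest_loss_region N r \<gamma>"
proof -
  have le_iff: "enn2ereal (r s) \<le> ereal k \<longleftrightarrow> T - k \<le> q s / p s" if "s \<in> space N" for s k
    using r[OF that] T[OF that] by (auto simp: enn2ereal_ennreal)
  have level: "{s \<in> space N. enn2ereal (r s) \<le> ereal k} = {s \<in> space N. T - k \<le> q s / p s}" for k
    using le_iff by blast
  have reflect: "(\<forall>k. P (T - k)) \<longleftrightarrow> (\<forall>k. P k)" for P :: "real \<Rightarrow> bool"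
    by (metis diff_diff_eq2 add_diff_cancel_left')
  show ?thesis
  proof (rule set_eqI)
    fix \<psi>
    show "\<psi> \<in> rel_surprise_region N p q \<gamma> \<longleftrightarrow> \<psi> \<in> lowest_loss_region N r \<gamma>"
    proof (cases "\<psi> \<in> space N")
      case True
      show ?thesis
        using reflect[of "\<lambda>k. \<gamma> \<le> measure N {s \<in> space N. k \<le> q s / p s} \<longrightarrow> k \<le> q \<psi> / p \<psi>"]
        unfolding mem_rel_surprise_region_iff mem_lowest_loss_region_iff level le_iff[OF True]
        by simp
    qed (simp add: mem_rel_surprise_region_iff mem_lowest_loss_region_iff)
  qed
qed

text \<open>
  The loss depends on \<open>\<theta>\<close> only through \<open>\<Psi> \<theta>\<close>, so its posterior expectation is a sum over \<open>S\<close>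
  weighted by the marginal posterior density \<open>q\<close>. Dividing the error indicator by \<open>p\<close> turns
  each weight into the ratio \<open>q s / p s\<close>, and the correct value alone contributes
  nothing.
\<close>

lemma posterior_risk_rel_surprise_loss:
  assumes meas: "posterior_density \<nu> \<pi> f x \<in> borel_measurable \<nu>"
    and fin: "finite S"
    and dist: "distributed (posterior \<nu> \<pi> f x) (count_space S) \<Psi> q"
    and p: "\<And>s. s \<in> S \<Longrightarrow> 0 < p s"
    and q: "\<And>s. s \<in> S \<Longrightarrow> 0 \<le> q s"
    and \<psi>: "\<psi> \<in> S"
  shows "posterior_risk \<nu> \<pi> f (rel_surprise_loss p \<Psi>) x \<psi> =
    ennreal ((\<Sum>s\<in>S. q s / p s) - q \<psi> / p \<psi>)"
proof -
  define l where "l s = of_bool (s \<noteq> \<psi>) / p s" for s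
  have l_nonneg: "0 \<le> l s" if "s \<in> S" for s
    using p[OF that] by (simp add: l_def)
  have \<Psi>[measurable]: "\<Psi> \<in> \<nu> \<rightarrow>\<^sub>M count_space S"
    using distributed_measurable[OF dist] by (simp add: posterior_def)
  have \<Psi>_in: "\<Psi> \<theta> \<in> S" if "\<theta> \<in> space \<nu>" for \<theta>
    using measurable_space[OF \<Psi> that] by simp
  have "posterior_risk \<nu> \<pi> f (rel_surprise_loss p \<Psi>) x \<psi> =
      (\<integral>\<^sup>+ \<theta>. ennreal (posterior_density \<nu> \<pi> f x \<theta>) * ennreal (l (\<Psi> \<theta>)) \<partial>\<nu>)"
    unfolding posterior_risk_def
    by (intro nn_integral_cong)
       (simp add: rel_surprise_loss_def l_def[symmetric] ennreal_mult' l_nonneg \<Psi>_in mult.commute)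
  also have "\<dots> = (\<integral>\<^sup>+ \<theta>. ennreal (l (\<Psi> \<theta>)) \<partial>posterior \<nu> \<pi> f x)"
    unfolding posterior_def using meas
    by (intro nn_integral_density[symmetric] measurable_compose[OF \<Psi>]) auto
  also have "\<dots> = (\<integral>\<^sup>+ s. ennreal (q s) * ennreal (l s) \<partial>count_space S)"
    by (intro distributed_nn_integral[OF dist, symmetric]) simp
  also have "\<dots> = (\<Sum>s\<in>S. ennreal (q s * l s))"
    using fin by (simp add: nn_integral_count_space_finite ennreal_mult q l_nonneg)
  also have "\<dots> = ennreal (\<Sum>s\<in>S. q s * l s)"
    by (simp add: sum_ennreal q l_nonneg)
  also have "(\<Sum>s\<in>S. q s * l s) = (\<Sum>s\<in>S - {\<psi>}. q s / p s)"
    using fin by (intro sum.mono_neutral_cong_right) (auto simp: l_def)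
  also have "\<dots> = (\<Sum>s\<in>S. q s / p s) - q \<psi> / p \<psi>"
    using fin \<psi> by (simp add: sum_diff1)
  finally show ?thesis .
qed

theorem theorem8:
  fixes \<mu> :: "'x measure" and \<nu> :: "'t measure"
    and f :: "'t \<Rightarrow> 'x \<Rightarrow> real" and \<pi> :: "'t \<Rightarrow> real"
    and \<Psi> :: "'t \<Rightarrow> 's" and S :: "'s set"
    and \<pi>\<^sub>\<Psi> :: "'s \<Rightarrow> real" and \<pi>\<^sub>\<Psi>_post :: "'x \<Rightarrow> 's \<Rightarrow> real"
    and \<gamma> :: real and x :: 'x
  assumes "\<And>\<theta>. \<theta> \<in> space \<nu> \<Longrightarrow> is_prob_density \<mu> (f \<theta>)"
    and "\<And>y. y \<in> space \<mu> \<Longrightarrow> (\<lambda>\<theta>. f \<theta> y) \<in> borel_measurable \<nu>"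
    and "is_prob_density \<nu> \<pi>"
    and "finite S"
    and "distributed (prior \<nu> \<pi>) (count_space S) \<Psi> \<pi>\<^sub>\<Psi>"
    and "\<And>\<psi>. \<psi> \<in> S \<Longrightarrow> 0 < \<pi>\<^sub>\<Psi> \<psi>"
    and "x \<in> space \<mu>"
    and "0 < prior_predictive \<nu> \<pi> f x" and "prior_predictive \<nu> \<pi> f x < \<infinity>"
    and "distributed (posterior \<nu> \<pi> f x) (count_space S) \<Psi> (\<pi>\<^sub>\<Psi>_post x)"
    and "\<And>\<psi>. \<psi> \<in> S \<Longrightarrow> 0 \<le> \<pi>\<^sub>\<Psi>_post x \<psi>"
    and "0 \<le> \<gamma>" and "\<gamma> \<le> 1"
  shows "rel_surprise_region (distr (posterior \<nu> \<pi> f x) (count_space S) \<Psi>) \<pi>\<^sub>\<Psi> (\<pi>\<^sub>\<Psi>_post x) \<gamma> =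
    lowest_loss_region (distr (posterior \<nu> \<pi> f x) (count_space S) \<Psi>)
      (posterior_risk \<nu> \<pi> f (rel_surprise_loss \<pi>\<^sub>\<Psi> \<Psi>) x) \<gamma>"
proof (rule rel_surprise_region_eq_lowest_loss_region[where T = "\<Sum>s\<in>S. \<pi>\<^sub>\<Psi>_post x s / \<pi>\<^sub>\<Psi> s"])
  fix s
  assume "s \<in> space (distr (posterior \<nu> \<pi> f x) (count_space S) \<Psi>)"
  then have s: "s \<in> S"
    by simp
  have "\<pi> \<in> borel_measurable \<nu>"
    using assms(3) by (simp add: is_prob_density_def)
  then have "posterior_density \<nu> \<pi> f x \<in> borel_measurable \<nu>"
    unfolding posterior_density_def[abs_def] using assms(2)[OF assms(7)] by measurable
  then show "posterior_risk \<nu> \<pi> f (rel_surprise_loss \<pi>\<^sub>\<Psi> \<Psi>) x s =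
      ennreal ((\<Sum>s\<in>S. \<pi>\<^sub>\<Psi>_post x s / \<pi>\<^sub>\<Psi> s) - \<pi>\<^sub>\<Psi>_post x s / \<pi>\<^sub>\<Psi> s)"
    using assms(4,10,6,11) s by (rule posterior_risk_rel_surprise_loss)
  show "\<pi>\<^sub>\<Psi>_post x s / \<pi>\<^sub>\<Psi> s \<le> (\<Sum>s\<in>S. \<pi>\<^sub>\<Psi>_post x s / \<pi>\<^sub>\<Psi> s)"
    using assms(4,6,11) s by (intro member_le_sum) (auto simp: less_imp_le)
qed

end
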